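(* Let $1<\alpha\le 2$, let $b\ge 2$ be a natural number, let $f:\mathbb{R}_+\to\mathbb{R}_+$ be continuous, and let $q:[\alpha-1,\alpha+b]_{\mathbb{N}_{\alpha-1}}\to\mathbb{R}_+$ be a nontrivial (not identically zero) function. Let $G$, $\lambda$, $\gamma$ and $\overset{\ast}{\gamma}$ be as defined in the context. Assume that there exist two positive constants $r_2>r_1>0$ such that $f(y)\ge \overset{\ast}{\gamma}\,r_1$ for all $y\in[0,r_1]$ and $f(y)\le \gamma\, r_2$ for all $y\in[0,r_2]$. Then the discrete fractional boundary value problem $$\begin{cases}(\triangle^{\alpha}y)(t)+q(t+\alpha-1)f(y(t+\alpha-1))=0,\quad t\in\{0,1,\dots,b+1\},\\ y(\alpha-2)=y(\alpha+b+1)=0\end{cases}$$ has at least one nontrivial positive solution $y\in X$ such that $r_1\le\|y\|\le r_2$.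
   Context: $\mathbb{R}_+=[0,\infty)$. For $a\in\mathbb{R}$, $\mathbb{N}_a=\{a,a+1,a+2,\dots\}$, and $[c,d]_{\mathbb{N}_a}=[c,d]\cap\mathbb{N}_a$. The power function is $x^{[y]}=\frac{\Gamma(x+1)}{\Gamma(x-y+1)}$ wherever the right-hand side is defined. For $g:\mathbb{N}_a\to\mathbb{R}$ and $\nu>0$, the discrete fractional sum of order $\nu$ is $({}_a\triangle_t^{-\nu}g)(t)=\frac{1}{\Gamma(\nu)}\sum_{s=a}^{t-\nu}(t-s-1)^{[\nu-1]}g(s)$ for $t\in\mathbb{N}_{a+\nu}$, where $s$ runs over $a,a+1,\dots,t-\nu$; for $\nu=0$ it is the identity. The discrete fractional difference of order $\alpha$ with $1<\alpha\le2$ is $(\triangle^\alpha g)(t)=(\triangle^2\,{}_a\triangle_t^{-(2-\alpha)}g)(t)$ for $t\in\mathbb{N}_{a+2-\alpha}$, where $\triangle^2$ is the standard second-order forward difference. In the boundary value problem $a=\alpha-2$, so $t$ ranges over integers; for $0\le t\le b+1$, $(\triangle^\alpha y)(t)$ only involves the values of $y$ on $[\alpha-2,\alpha+b+1]_{\mathbb{N}_{\alpha-2}}$. $X$ is the Banach space of functions $y:[\alpha-2,\alpha+b+1]_{\mathbb{N}_{\alpha-2}}\to\mathbb{R}$ with $y(\alpha-2)=y(\alpha+b+1)=0$, with the supremum norm $\|\cdot\|$. A positive solution is a solution $y\in X$ with $y(t)>0$ for all $t\in[\alpha-1,\alpha+b]_{\mathbb{N}_{\alpha-1}}$. The Green function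 $G$ is defined, for $t\in[\alpha-1,\alpha+b]_{\mathbb{N}_{\alpha-1}}$ and integers $0\le s\le b+1$, by $$G(t,s)=\frac{1}{\Gamma(\alpha)}\begin{cases}\dfrac{t^{[\alpha-1]}(\alpha+b-s)^{[\alpha-1]}}{(\alpha+b+1)^{[\alpha-1]}}-(t-s-1)^{[\alpha-1]}, & s<t-\alpha+1\le b+1,\\[2mm] \dfrac{t^{[\alpha-1]}(\alpha+b-s)^{[\alpha-1]}}{(\alpha+b+1)^{[\alpha-1]}}, & t-\alpha+1\le s\le b+1.\end{cases}$$ $\lambda\in(0,1)$ is a fixed constant such that $\min_{t\in[\frac{b+\alpha}{4},\frac{3(b+\alpha)}{4}]_{\mathbb{N}_{\alpha-1}}}G(t,s)\ge\lambda\max_{t\in[\alpha-1,\alpha+b]_{\mathbb{N}_{\alpha-1}}}G(t,s)=\lambda G(s+\alpha-1,s)$ for all integers $1\le s\le b+1$ (such a constant exists). Finally, $$\gamma=\Big(\sum_{s=0}^{b+1}G(s+\alpha-1,s)\,q(s+\alpha-1)\Big)^{-1},\qquad \overset{\ast}{\gamma}=\Big(\sum_{\frac{b+\alpha}{4}\le s\le\frac{3(b+\alpha)}{4}}\lambda\, G(s+\alpha-1,s)\,q(s+\alpha-1)\Big)^{-1},$$ where the second sum is over integers $s$ in the indicated range. It is understood that the second sum is nonzero, so that $\overset{\ast}{\gamma}$ is defined. *)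

theory Defs
  imports "HOL-Analysis.Analysis"
begin

definition shifted_nats :: "real \<Rightarrow> real set" where
  "shifted_nats a = {a + real k | k :: nat. True}"

definition discrete_ivl :: "real \<Rightarrow> real \<Rightarrow> real \<Rightarrow> real set" where
  "discrete_ivl c d a = {c..d} \<inter> shifted_nats a"

text \<open>
  The power function is totalised by the library conventions that \<open>Gamma\<close> is \<open>0\<close> at its poles
  and \<open>x / 0 = 0\<close>. Under the hypotheses \<open>1 < \<alpha> \<le> 2\<close> and \<open>b \<ge> 2\<close> of the boundary value problem,
  it is only evaluated below at points where both Gamma values are taken at positive arguments.
\<close>

definition falling_power :: "real \<Rightarrow> real \<Rightarrow> real" where
  "falling_power x y = Gamma (x + 1) / Gamma (x - y + 1)"

definition frac_sum :: "real \<Rightarrow> real \<Rightarrow> (real \<Rightarrow> real) \<Rightarrow> real \<Rightarrow> real" where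
  "frac_sum a \<nu> g t =
     (if \<nu> = 0 then g t
      else 1 / Gamma \<nu> *
        (\<Sum>s\<in>{s \<in> shifted_nats a. s \<le> t - \<nu>}. falling_power (t - s - 1) (\<nu> - 1) * g s))"

definition forward_diff :: "(real \<Rightarrow> real) \<Rightarrow> real \<Rightarrow> real" where
  "forward_diff g t = g (t + 1) - g t"

text \<open>
  Fractional difference of order \<open>\<alpha>\<close> for \<open>1 < \<alpha> \<le> 2\<close> (so the integer order of the outer
  difference is \<open>2\<close>), for functions on \<open>shifted_nats a\<close>.
\<close>

definition frac_diff :: "real \<Rightarrow> real \<Rightarrow> (real \<Rightarrow> real) \<Rightarrow> real \<Rightarrow> real" where
  "frac_diff a \<alpha> g = (forward_diff ^^ 2) (frac_sum a (2 - \<alpha>) g)"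

text \<open>
  A function on the finite grid is represented by its extensional extension, so that elements of
  the space below correspond exactly to functions on the grid.
\<close>

definition bvp_space :: "real \<Rightarrow> nat \<Rightarrow> (real \<Rightarrow> real) set" where
  "bvp_space \<alpha> b =
     {y \<in> extensional (discrete_ivl (\<alpha> - 2) (\<alpha> + real b + 1) (\<alpha> - 2)).
        y (\<alpha> - 2) = 0 \<and> y (\<alpha> + real b + 1) = 0}"

definition bvp_norm :: "real \<Rightarrow> nat \<Rightarrow> (real \<Rightarrow> real) \<Rightarrow> real" where
  "bvp_norm \<alpha> b y =
     (SUP t\<in>discrete_ivl (\<alpha> - 2) (\<alpha> + real b + 1) (\<alpha> - 2). \<bar>y t\<bar>)"

definition bvp_solution ::
  "real \<Rightarrow> nat \<Rightarrow> (real \<Rightarrow> real) \<Rightarrow> (real \<Rightarrow> real) \<Rightarrow> (real \<Rightarrow> real) \<Rightarrow> bool" where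
  "bvp_solution \<alpha> b q f y \<longleftrightarrow>
     (\<forall>t\<in>{0..b + 1}.
        frac_diff (\<alpha> - 2) \<alpha> y (real t) + q (real t + \<alpha> - 1) * f (y (real t + \<alpha> - 1)) = 0) \<and>
     y (\<alpha> - 2) = 0 \<and> y (\<alpha> + real b + 1) = 0"

definition bvp_positive_solution ::
  "real \<Rightarrow> nat \<Rightarrow> (real \<Rightarrow> real) \<Rightarrow> (real \<Rightarrow> real) \<Rightarrow> (real \<Rightarrow> real) \<Rightarrow> bool" where
  "bvp_positive_solution \<alpha> b q f y \<longleftrightarrow>
     y \<in> bvp_space \<alpha> b \<and> bvp_solution \<alpha> b q f y \<and>
     (\<forall>t\<in>discrete_ivl (\<alpha> - 1) (\<alpha> + real b) (\<alpha> - 1). y t > 0)"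

text \<open>
  Only used for \<open>t \<in> discrete_ivl (\<alpha> - 1) (\<alpha> + b) (\<alpha> - 1)\<close> and \<open>s \<le> b + 1\<close>; there
  \<open>t - \<alpha> + 1 \<le> b + 1\<close> holds automatically, so the two cases are distinguished by
  \<open>s < t - \<alpha> + 1\<close> alone.
\<close>

definition green :: "real \<Rightarrow> nat \<Rightarrow> real \<Rightarrow> nat \<Rightarrow> real" where
  "green \<alpha> b t s = 1 / Gamma \<alpha> *
     (if real s < t - \<alpha> + 1
      then falling_power t (\<alpha> - 1) * falling_power (\<alpha> + real b - real s) (\<alpha> - 1)
             / falling_power (\<alpha> + real b + 1) (\<alpha> - 1)
           - falling_power (t - real s - 1) (\<alpha> - 1)
      else falling_power t (\<alpha> - 1) * falling_power (\<alpha> + real b - real s) (\<alpha> - 1)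
             / falling_power (\<alpha> + real b + 1) (\<alpha> - 1))"

definition green_constant :: "real \<Rightarrow> nat \<Rightarrow> real \<Rightarrow> bool" where
  "green_constant \<alpha> b c \<longleftrightarrow> 0 < c \<and> c < 1 \<and>
     (\<forall>s\<in>{1..b + 1}.
        Min ((\<lambda>t. green \<alpha> b t s) `
          discrete_ivl ((real b + \<alpha>) / 4) (3 * (real b + \<alpha>) / 4) (\<alpha> - 1))
        \<ge> c * Max ((\<lambda>t. green \<alpha> b t s) ` discrete_ivl (\<alpha> - 1) (\<alpha> + real b) (\<alpha> - 1)))"

definition gamma_const :: "real \<Rightarrow> nat \<Rightarrow> (real \<Rightarrow> real) \<Rightarrow> real" where
  "gamma_const \<alpha> b q =
     inverse (\<Sum>s\<in>{0..b + 1}. green \<alpha> b (real s + \<alpha> - 1) s * q (real s + \<alpha> - 1))"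

text \<open>
  The lower end of the range of summation is positive when \<open>\<alpha> > 0\<close>, so the integers in this range
  are natural numbers.
\<close>

definition gamma_star_sum :: "real \<Rightarrow> nat \<Rightarrow> (real \<Rightarrow> real) \<Rightarrow> real \<Rightarrow> real" where
  "gamma_star_sum \<alpha> b q c =
     (\<Sum>s\<in>{s :: nat. (real b + \<alpha>) / 4 \<le> real s \<and> real s \<le> 3 * (real b + \<alpha>) / 4}.
        c * green \<alpha> b (real s + \<alpha> - 1) s * q (real s + \<alpha> - 1))"

definition gamma_star :: "real \<Rightarrow> nat \<Rightarrow> (real \<Rightarrow> real) \<Rightarrow> real \<Rightarrow> real" where
  "gamma_star \<alpha> b q c = inverse (gamma_star_sum \<alpha> b q c)"

end

theory Submission
  imports Defs
begin

text \<open>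
  Index the grid by integers, \<open>y i = y(\<alpha> - 1 + i)\<close>, and let \<open>K\<close> be the sequence of coefficients
  of \<open>(1 - x)\<close> to the power \<open>-\<alpha>\<close>. Up to a factor \<open>Gamma \<alpha>\<close> it is the power function with
  exponent \<open>\<alpha> - 1\<close> on the grid. In the same way the kernel of the fractional sum of order
  \<open>2 - \<alpha>\<close> consists of the coefficients of \<open>(1 - x)\<close> to the power \<open>\<alpha> - 2\<close>. Convolving the two
  gives the coefficients \<open>n + 1\<close> of the power \<open>-2\<close>, which the second difference cancels.
  Consequently, for every \<open>c\<close>, the recursion
  \<open>y k = c * K k - (\<Sum>s<k. K (k - 1 - s) * F s)\<close> solves the initial value problem with left
  boundary value \<open>0\<close> and fractional difference \<open>-F\<close> (lemma \<open>frac_diff_of_convolution\<close>).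

  The boundary value problem is solved by shooting in the single parameter \<open>c\<close>. Replace
  \<open>f(y)\<close> by \<open>f\<close> at the truncation of \<open>y\<close> to \<open>[0, r2]\<close>. Then \<open>F\<close> is bounded and depends continuously
  on \<open>c\<close>, so the value at the right end point is \<open>c\<close> times a positive number up to a bounded
  error, and the intermediate value theorem yields a \<open>c\<close> for which it vanishes
  (lemma \<open>shoot_hits_zero\<close>). Eliminating \<open>c\<close> shows that this \<open>y\<close> satisfies
  \<open>y i = (\<Sum>s. G i s * F s)\<close> with Green's function \<open>G\<close>.

  Now \<open>G\<close> is positive and each \<open>G i s\<close> is at most the diagonal value \<open>G s s\<close>
  (lemmas \<open>conv_green_pos\<close>, \<open>conv_green_le_diagonal\<close>). Hence \<open>y\<close> is nonnegative and the upper
  bound on \<open>f\<close> gives \<open>y \<le> r2\<close>, so the truncation was inactive and \<open>y\<close> solves the original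
  problem. If all values of \<open>y\<close> were below \<open>r1\<close>, the lower bound on \<open>f\<close> would hold at every
  grid point, and at any point of the middle half of the grid the Green representation would
  produce a value of at least \<open>r1\<close>, a contradiction. Thus \<open>y\<close> is not zero, some \<open>F s\<close> is
  positive, and positivity of \<open>G\<close> makes \<open>y\<close> positive throughout the interior.
\<close>

section \<open>Coefficients of the negative binomial series\<close>

text \<open>
  This is the coefficient of \<open>x ^ n\<close> in the series of \<open>(1 - x)\<close> to the power \<open>-a\<close>. The identities
  below are the coefficient forms of the rules for multiplying such powers.
\<close>

definition rising_coeff :: "real \<Rightarrow> nat \<Rightarrow> real" where
  "rising_coeff a n = pochhammer a n / fact n"

lemma rising_coeff_0 [simp]: "rising_coeff a 0 = 1"
  by (simp add: rising_coeff_def)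

lemma rising_coeff_Suc:
  "rising_coeff a (Suc n) = rising_coeff a n * (a + real n) / (real n + 1)"
  by (simp add: rising_coeff_def pochhammer_Suc field_simps)

lemma rising_coeff_pos: "0 < a \<Longrightarrow> 0 < rising_coeff a n"
  by (simp add: rising_coeff_def pochhammer_pos)

lemma rising_coeff_zero_left: "rising_coeff 0 n = (if n = 0 then 1 else 0)"
  by (simp add: rising_coeff_def pochhammer_0_left)

lemma rising_coeff_2: "rising_coeff 2 n = real n + 1"
  by (induction n) (auto simp: rising_coeff_Suc field_simps)

lemma rising_coeff_nonneg: "0 \<le> a \<Longrightarrow> 0 \<le> rising_coeff a n"
  using rising_coeff_pos[of a n] by (cases "a = 0") (auto simp: rising_coeff_zero_left)

text \<open>Vandermonde's identity: exponents add when the series are multiplied.\<close>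

lemma rising_coeff_convolution:
  "(\<Sum>k\<le>n. rising_coeff a (n - k) * rising_coeff b k) = rising_coeff (a + b) n"
proof -
  have "rising_coeff (a + b) n = rising_coeff (b + a) n"
    by (simp add: add.commute)
  also have "\<dots> = (\<Sum>k\<le>n. of_nat (n choose k) * pochhammer b k * pochhammer a (n - k)) / fact n"
    by (simp add: rising_coeff_def pochhammer_binomial_sum)
  also have "\<dots> = (\<Sum>k\<le>n. rising_coeff a (n - k) * rising_coeff b k)"
    unfolding sum_divide_distrib
    by (rule sum.cong) (auto simp: rising_coeff_def binomial_fact field_simps)
  finally show ?thesis ..
qed

text \<open>Multiplying the series by \<open>1 - x\<close> takes differences of coefficients and lowers \<open>a\<close> by one.\<close>

lemma rising_coeff_diff:
  "rising_coeff a (Suc n) - rising_coeff a n = rising_coeff (a - 1) (Suc n)"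
proof (induction n)
  case 0
  show ?case by (simp add: rising_coeff_Suc)
next
  case (Suc n)
  have *: "rising_coeff a (Suc n) - rising_coeff a n
      = rising_coeff a n * (a - 1) / (real n + 1)" for n
    by (simp add: rising_coeff_Suc field_simps)
  have "rising_coeff (a - 1) (Suc (Suc n))
      = (rising_coeff a n * (a - 1) / (real n + 1)) * (a + real n) / (real n + 2)"
    using Suc by (simp add: rising_coeff_Suc[of _ "Suc n"] * add_ac flip: Suc)
  also have "\<dots> = rising_coeff a (Suc (Suc n)) - rising_coeff a (Suc n)"
    unfolding * by (simp add: rising_coeff_Suc[of _ n] add_ac)
  finally show ?case ..
qed

lemma rising_coeff_mono:
  assumes "1 \<le> a" "m \<le> n"
  shows "rising_coeff a m \<le> rising_coeff a n"
proof (rule lift_Suc_mono_le[OF _ assms(2)])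
  show "rising_coeff a k \<le> rising_coeff a (Suc k)" for k
    using rising_coeff_diff[of a k] rising_coeff_nonneg[of "a - 1" "Suc k"] assms(1) by simp
qed

lemma rising_coeff_antimono:
  assumes "0 \<le> a" "a \<le> 1" "m \<le> n"
  shows "rising_coeff a n \<le> rising_coeff a m"
proof (rule lift_Suc_antimono_le[OF _ assms(3)])
  fix k
  have "rising_coeff a k * ((a + real k) / (real k + 1)) \<le> rising_coeff a k * 1"
    using assms rising_coeff_nonneg[of a k] by (intro mult_left_mono) auto
  then show "rising_coeff a (Suc k) \<le> rising_coeff a k"
    by (simp add: rising_coeff_Suc)
qed

text \<open>
  The quotient \<open>rising_coeff a (k + m) / rising_coeff a k\<close> is a product of \<open>m\<close> factors
  \<open>(a + j) / (j + 1)\<close>, and for \<open>a > 1\<close> these decrease with \<open>j\<close>. This is the source of the strict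
  positivity of Green's function.
\<close>

lemma rising_coeff_ratio_strict_antimono:
  assumes "1 < a" "0 < m" "k < l"
  shows "rising_coeff a (l + m) * rising_coeff a k < rising_coeff a (k + m) * rising_coeff a l"
proof -
  let ?R = "\<lambda>k. rising_coeff a (k + m) / rising_coeff a k"
  have pos: "0 < rising_coeff a j" for j
    using assms(1) by (intro rising_coeff_pos) simp
  have "?R (Suc j) < ?R j" for j
  proof -
    have "real m * (real j + 1) < real m * (a + real j)"
      using assms by (intro mult_strict_left_mono) auto
    then have "(a + real j + real m) * (real j + 1) < (real j + real m + 1) * (a + real j)"
      by (simp add: algebra_simps)
    then have "(a + real j + real m) * (real j + 1) / ((real j + real m + 1) * (a + real j)) < 1"
      using assms by (subst divide_less_eq_1_pos) auto
    moreover have "?R (Suc j) =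
        ?R j * ((a + real j + real m) * (real j + 1) / ((real j + real m + 1) * (a + real j)))"
      by (simp add: rising_coeff_Suc mult_ac add_ac)
    moreover have "0 < ?R j"
      using pos by simp
    ultimately show ?thesis
      by (metis mult.right_neutral mult_strict_left_mono)
  qed
  then have "- ?R k < - ?R l"
    using lift_Suc_mono_less[of "\<lambda>j. - ?R j" k l] assms(3) by auto
  then show ?thesis
    using pos[of k] pos[of l] by (simp add: field_simps)
qed

lemma falling_power_eq_rising_coeff:
  assumes "0 < a"
  shows "falling_power (a - 1 + real n) (a - 1) = Gamma a * rising_coeff a n"
proof -
  have "a \<notin> \<int>\<^sub>\<le>\<^sub>0" using assms by (auto elim!: nonpos_Ints_cases)
  moreover have "Gamma a \<noteq> 0" using Gamma_real_pos[OF assms] by (rule less_imp_neq[symmetric])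
  ultimately show ?thesis
    by (simp add: falling_power_def rising_coeff_def pochhammer_Gamma Gamma_fact add_ac)
qed

section \<open>The fractional difference as a convolution\<close>

lemma discrete_ivl_eq_image:
  "discrete_ivl a (a + real n) a = (\<lambda>k. a + real k) ` {..n}"
  by (auto simp: discrete_ivl_def shifted_nats_def)

lemma finite_discrete_ivl: "finite (discrete_ivl c d a)"
proof (rule finite_subset)
  show "discrete_ivl c d a \<subseteq> (\<lambda>k. a + real k) ` {..nat \<lceil>d - a\<rceil>}"
  proof
    fix t assume "t \<in> discrete_ivl c d a"
    then obtain k where k: "t = a + real k" "a + real k \<le> d"
      by (auto simp: discrete_ivl_def shifted_nats_def)
    then have "k \<le> nat \<lceil>d - a\<rceil>" by linarith
    then show "t \<in> (\<lambda>k. a + real k) ` {..nat \<lceil>d - a\<rceil>}" using k(1) by blast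
  qed
qed simp

text \<open>
  For \<open>\<nu> = 0\<close> the formula remains true because the coefficients of order \<open>0\<close> are those
  of the constant series \<open>1\<close>, so the identity case of the definition, which occurs below when
  \<open>\<alpha> = 2\<close>, does not have to be treated separately afterwards.
\<close>

lemma frac_sum_eq_convolution:
  assumes "0 \<le> \<nu>"
  shows "frac_sum a \<nu> g (a + \<nu> + real n) = (\<Sum>k\<le>n. rising_coeff \<nu> (n - k) * g (a + real k))"
proof (cases "\<nu> = 0")
  case True
  have "(\<Sum>k\<le>n. rising_coeff \<nu> (n - k) * g (a + real k))
      = (\<Sum>k\<in>{n}. rising_coeff \<nu> (n - k) * g (a + real k))"
    by (rule sum.mono_neutral_right) (auto simp: True rising_coeff_zero_left)
  then show ?thesis by (simp add: True frac_sum_def)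
next
  case False
  then have \<nu>: "0 < \<nu>" using assms by simp
  then have \<Gamma>: "Gamma \<nu> \<noteq> 0" using Gamma_real_pos by (metis less_irrefl)
  have set_eq: "{s \<in> shifted_nats a. s \<le> a + \<nu> + real n - \<nu>} = (\<lambda>k. a + real k) ` {..n}"
    by (auto simp: shifted_nats_def)
  have weight: "falling_power (a + \<nu> + real n - (a + real k) - 1) (\<nu> - 1)
      = Gamma \<nu> * rising_coeff \<nu> (n - k)" if "k \<le> n" for k
  proof -
    have "a + \<nu> + real n - (a + real k) - 1 = \<nu> - 1 + real (n - k)"
      using that by (simp add: of_nat_diff)
    then show ?thesis using falling_power_eq_rising_coeff[OF \<nu>] by metis
  qed
  have "(\<Sum>s\<in>(\<lambda>k. a + real k) ` {..n}. falling_power (a + \<nu> + real n - s - 1) (\<nu> - 1) * g s)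
      = (\<Sum>k\<le>n. falling_power (a + \<nu> + real n - (a + real k) - 1) (\<nu> - 1) * g (a + real k))"
    by (subst sum.reindex) (auto simp: inj_on_def)
  also have "\<dots> = (\<Sum>k\<le>n. Gamma \<nu> * (rising_coeff \<nu> (n - k) * g (a + real k)))"
    by (rule sum.cong) (simp_all only: weight atMost_iff mult.assoc)
  finally have "(\<Sum>s\<in>(\<lambda>k. a + real k) ` {..n}. falling_power (a + \<nu> + real n - s - 1) (\<nu> - 1) * g s)
      = (\<Sum>k\<le>n. Gamma \<nu> * (rising_coeff \<nu> (n - k) * g (a + real k)))" .
  then show ?thesis
    using False \<Gamma> by (simp only: frac_sum_def set_eq if_False sum_distrib_left[symmetric])
      simp
qed

text \<open>
  The convolution with the kernel of order \<open>2 - \<alpha>\<close> turns the coefficients of order \<open>\<alpha>\<close> into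
  those of order \<open>2\<close>, which are linear in the index. The fractional sum of \<open>g\<close> is therefore the
  solution formula of the ordinary second order initial value problem with slope \<open>c\<close> and
  right-hand side \<open>-F\<close>.
\<close>

lemma frac_diff_of_convolution:
  assumes "0 < \<alpha>" "\<alpha> \<le> 2"
    and g0: "g (\<alpha> - 2) = 0"
    and g: "\<And>k. k \<le> Suc t \<Longrightarrow> g (\<alpha> - 1 + real k)
      = c * rising_coeff \<alpha> k - (\<Sum>s<k. rising_coeff \<alpha> (k - 1 - s) * F s)"
  shows "frac_diff (\<alpha> - 2) \<alpha> g (real t) = - F t"
proof -
  let ?w = "rising_coeff (2 - \<alpha>)" and ?K = "rising_coeff \<alpha>"
  have conv: "(\<Sum>k\<le>n. ?w (n - k) * ?K k) = real n + 1" for n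
    by (simp add: rising_coeff_convolution rising_coeff_2)
  have fs: "frac_sum (\<alpha> - 2) (2 - \<alpha>) g (real n) = (\<Sum>k\<le>n. ?w (n - k) * g (\<alpha> - 2 + real k))" for n
    using frac_sum_eq_convolution[of "2 - \<alpha>" "\<alpha> - 2" g n] assms(2) by simp
  have S: "frac_sum (\<alpha> - 2) (2 - \<alpha>) g (real n) = c * real n - (\<Sum>s<n. (real n - 1 - real s) * F s)"
    if "n \<le> Suc (Suc t)" for n
  proof (cases n)
    case 0
    then show ?thesis using fs[of n] g0 by simp
  next
    case (Suc m)
    \<comment> \<open>After exchanging the order of summation, the inner sum is again a Vandermonde convolution.\<close>
    have inner: "(\<Sum>k=Suc j..m. ?w (m - k) * (?K (k - 1 - j) * F j)) = (real m - real j) * F j"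
      if "j < m" for j
    proof -
      have "(\<Sum>k=Suc j..m. ?w (m - k) * ?K (k - 1 - j))
          = (\<Sum>i\<le>m - 1 - j. ?w (m - 1 - j - i) * ?K i)"
        by (rule sum.reindex_bij_witness[of _ "\<lambda>i. i + Suc j" "\<lambda>k. k - 1 - j"])
           (use that in \<open>auto intro!: arg_cong[of _ _ ?w]\<close>)
      also have "\<dots> = real m - real j"
        using that unfolding conv by (simp add: of_nat_diff)
      finally show ?thesis by (simp flip: sum_distrib_right mult.assoc)
    qed
    have "frac_sum (\<alpha> - 2) (2 - \<alpha>) g (real n)
        = (\<Sum>k\<le>m. ?w (m - k) * g (\<alpha> - 2 + real (Suc k)))"
      unfolding fs Suc sum.atMost_Suc_shift using g0 by simp
    also have "\<dots> = (\<Sum>k\<le>m. ?w (m - k) * (c * ?K k - (\<Sum>s<k. ?K (k - 1 - s) * F s)))"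
    proof (rule sum.cong)
      fix k assume "k \<in> {..m}"
      then have "k \<le> Suc t" using that Suc by simp
      moreover have "\<alpha> - 2 + real (Suc k) = \<alpha> - 1 + real k" by simp
      ultimately show "?w (m - k) * g (\<alpha> - 2 + real (Suc k))
          = ?w (m - k) * (c * ?K k - (\<Sum>s<k. ?K (k - 1 - s) * F s))"
        using g[of k] by metis
    qed simp
    also have "\<dots> = c * (\<Sum>k\<le>m. ?w (m - k) * ?K k)
        - (\<Sum>k\<le>m. \<Sum>s<k. ?w (m - k) * (?K (k - 1 - s) * F s))"
      by (simp add: right_diff_distrib sum_subtractf sum_distrib_left mult_ac)
    also have "(\<Sum>k\<le>m. \<Sum>s<k. ?w (m - k) * (?K (k - 1 - s) * F s))
        = (\<Sum>s<m. (real m - real s) * F s)"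
      unfolding sum.nested_swap' by (rule sum.cong) (simp_all only: inner lessThan_iff)
    finally show ?thesis
      by (simp add: Suc conv)
  qed
  have "frac_diff (\<alpha> - 2) \<alpha> g (real t)
      = frac_sum (\<alpha> - 2) (2 - \<alpha>) g (real (Suc (Suc t)))
        - 2 * frac_sum (\<alpha> - 2) (2 - \<alpha>) g (real (Suc t)) + frac_sum (\<alpha> - 2) (2 - \<alpha>) g (real t)"
    by (simp add: frac_diff_def forward_diff_def numeral_2_eq_2 add_ac)
  also have "\<dots> = - (\<Sum>s<t. (real t + 1 - real s) * F s) + 2 * (\<Sum>s<t. (real t - real s) * F s)
      - (\<Sum>s<t. (real t - 1 - real s) * F s) - F t"
    unfolding S[OF order_refl] S[OF le_SucI[OF order_refl]] S[OF le_SucI[OF le_SucI[OF order_refl]]]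
    by (simp add: algebra_simps)
  also have "\<dots> = - F t"
    by (simp add: sum_distrib_left algebra_simps flip: sum_subtractf sum.distrib sum_negf)
  finally show ?thesis .
qed

section \<open>Green's function\<close>

text \<open>
  Green's function of the recursion \<open>y k = c * K k - (\<Sum>s<k. K (k - 1 - s) * F s)\<close> with the
  condition \<open>y N = 0\<close>: the first term is the share of \<open>F s\<close> in the value of \<open>c\<close> enforced by
  that condition, the second one is the direct effect of \<open>F s\<close> on later values.
\<close>

definition conv_green :: "(nat \<Rightarrow> real) \<Rightarrow> nat \<Rightarrow> nat \<Rightarrow> nat \<Rightarrow> real" where
  "conv_green K N i s = K i * K (N - 1 - s) / K N - (if s < i then K (i - 1 - s) else 0)"

lemma green_eq_conv_green:
  assumes "0 < \<alpha>" "s \<le> b + 1"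
  shows "green \<alpha> b (\<alpha> - 1 + real i) s = conv_green (rising_coeff \<alpha>) (b + 2) i s"
proof -
  have \<Gamma>: "Gamma \<alpha> \<noteq> 0" using Gamma_real_pos[OF assms(1)] by (rule less_imp_neq[symmetric])
  note fp = falling_power_eq_rising_coeff[OF assms(1)]
  have f1: "falling_power (\<alpha> - 1 + real i) (\<alpha> - 1) = Gamma \<alpha> * rising_coeff \<alpha> i"
    by (rule fp)
  have f2: "falling_power (\<alpha> + real b - real s) (\<alpha> - 1)
      = Gamma \<alpha> * rising_coeff \<alpha> (b + 2 - 1 - s)"
    using fp[of "b + 2 - 1 - s"] assms(2) by (simp add: of_nat_diff algebra_simps)
  have f3: "falling_power (\<alpha> + real b + 1) (\<alpha> - 1) = Gamma \<alpha> * rising_coeff \<alpha> (b + 2)"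
    using fp[of "b + 2"] by (simp add: algebra_simps)
  have f4: "falling_power (\<alpha> - 1 + real i - real s - 1) (\<alpha> - 1)
      = Gamma \<alpha> * rising_coeff \<alpha> (i - 1 - s)" if "s < i"
    using fp[of "i - 1 - s"] that by (simp add: of_nat_diff algebra_simps)
  have less: "real s < \<alpha> - 1 + real i - \<alpha> + 1 \<longleftrightarrow> s < i"
    by simp
  show ?thesis
  proof (cases "s < i")
    case True
    show ?thesis
      unfolding green_def conv_green_def less f1 f2 f3 f4[OF True]
      using \<Gamma> True by (simp add: right_diff_distrib)
  next
    case False
    show ?thesis
      unfolding green_def conv_green_def less f1 f2 f3
      using \<Gamma> False by simp
  qed
qed

text \<open>Solving \<open>y N = 0\<close> for \<open>c\<close> and inserting the result into the recursion gives the kernel.\<close>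

lemma conv_green_representation:
  assumes "K N \<noteq> 0"
    and y: "\<And>k. y k = c * K k - (\<Sum>s<k. K (k - 1 - s) * F s)"
    and "y N = 0" "i \<le> N"
  shows "y i = (\<Sum>s<N. conv_green K N i s * F s)"
proof -
  have c: "c = (\<Sum>s<N. K (N - 1 - s) * F s) / K N"
    using y[of N] assms(1,3) by (simp add: field_simps)
  have "(\<Sum>s<i. K (i - 1 - s) * F s) = (\<Sum>s<N. if s < i then K (i - 1 - s) * F s else 0)"
    using assms(4) by (intro sum.mono_neutral_cong_left) auto
  also have "\<dots> = (\<Sum>s<N. (if s < i then K (i - 1 - s) else 0) * F s)"
    by (rule sum.cong) auto
  finally have "y i = (\<Sum>s<N. K (N - 1 - s) * F s) / K N * K i
      - (\<Sum>s<N. (if s < i then K (i - 1 - s) else 0) * F s)"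
    using y[of i] c by simp
  also have "\<dots> = (\<Sum>s<N. conv_green K N i s * F s)"
    unfolding conv_green_def left_diff_distrib sum_subtractf
    by (simp add: sum_divide_distrib sum_distrib_left mult_ac)
  finally show ?thesis .
qed

lemma conv_green_pos:
  assumes "1 < \<alpha>" "i < N" "s < N"
  shows "0 < conv_green (rising_coeff \<alpha>) N i s"
proof -
  let ?K = "rising_coeff \<alpha>"
  have pos: "0 < ?K n" for n using assms(1) by (intro rising_coeff_pos) simp
  show ?thesis
  proof (cases "s < i")
    case True
    have "?K (N - 1 - s + Suc s) * ?K (i - 1 - s) < ?K (i - 1 - s + Suc s) * ?K (N - 1 - s)"
      using assms True by (intro rising_coeff_ratio_strict_antimono) auto
    then have "?K N * ?K (i - 1 - s) < ?K i * ?K (N - 1 - s)"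
      using True assms by simp
    then show ?thesis
      using True pos[of N] by (simp add: conv_green_def field_simps)
  qed (simp add: conv_green_def pos)
qed

text \<open>
  Up to the diagonal Green's function grows with \<open>i\<close> because \<open>K\<close> does. From the diagonal on
  it decreases: the increments of \<open>K\<close> are the coefficients of order \<open>\<alpha> - 1\<close>, which form a
  nonincreasing sequence as \<open>\<alpha> \<le> 2\<close>, and the increment of the subtracted term is taken at an
  earlier index and is not scaled down by the factor \<open>\<rho> \<le> 1\<close>.
\<close>

lemma conv_green_le_diagonal:
  assumes "1 \<le> \<alpha>" "\<alpha> \<le> 2" "s < N"
  shows "conv_green (rising_coeff \<alpha>) N i s \<le> conv_green (rising_coeff \<alpha>) N s s"
proof -
  let ?K = "rising_coeff \<alpha>" and ?D = "rising_coeff (\<alpha> - 1)"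
  have pos: "0 < ?K n" for n using assms(1) by (intro rising_coeff_pos) simp
  define \<rho> where "\<rho> = ?K (N - 1 - s) / ?K N"
  have \<rho>: "0 \<le> \<rho>" "\<rho> \<le> 1"
    using pos[of N] pos[of "N - 1 - s"] rising_coeff_mono[of \<alpha> "N - 1 - s" N] assms
    by (auto simp: \<rho>_def)
  have G: "conv_green ?K N i s = \<rho> * ?K i - (if s < i then ?K (i - 1 - s) else 0)" for i
    by (simp add: conv_green_def \<rho>_def)
  show ?thesis
  proof (cases "i \<le> s")
    case True
    then show ?thesis
      using \<rho> rising_coeff_mono[of \<alpha> i s] assms(1) by (simp add: G mult_left_mono)
  next
    case False
    have step: "conv_green ?K N (Suc j) s \<le> conv_green ?K N j s" if "s \<le> j" for j
    proof -
      have "\<rho> * ?K (Suc j) - \<rho> * ?K j = \<rho> * ?D (Suc j)"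
        by (simp flip: rising_coeff_diff right_diff_distrib)
      also have "\<dots> \<le> ?D (Suc j)"
        using \<rho> assms(1) rising_coeff_nonneg[of "\<alpha> - 1" "Suc j"] by (intro mult_left_le_one_le) auto
      also have "\<dots> \<le> ?D (j - s)"
        using assms by (intro rising_coeff_antimono) auto
      \<comment> \<open>At \<open>j = s\<close> the subtracted term jumps from \<open>0\<close> to \<open>K 0 = 1\<close>, which is \<open>D 0\<close> as well.\<close>
      also have "\<dots> = ?K (j - s) - (if s < j then ?K (j - 1 - s) else 0)"
      proof (cases "s < j")
        case True
        then have "j - s = Suc (j - 1 - s)" by simp
        then show ?thesis using True rising_coeff_diff[of \<alpha> "j - 1 - s"] by simp
      qed (use that in simp)
      finally show ?thesis using that by (simp add: G)
    qed
    have "s \<le> i" using False by simp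
    then show ?thesis
      by (induction rule: dec_induct) (use step in force)+
  qed
qed

section \<open>Shooting\<close>

text \<open>
  The solution of the initial value problem with parameter \<open>c\<close> for the nonlinearity
  \<open>F s = \<phi> s (y s)\<close>.
\<close>

fun shoot :: "(nat \<Rightarrow> real) \<Rightarrow> (nat \<Rightarrow> real \<Rightarrow> real) \<Rightarrow> real \<Rightarrow> nat \<Rightarrow> real" where
  "shoot K \<phi> c k = c * K k - (\<Sum>s<k. K (k - 1 - s) * \<phi> s (shoot K \<phi> c s))"

declare shoot.simps [simp del]

lemma continuous_on_shoot:
  assumes "\<And>s. s < k \<Longrightarrow> continuous_on UNIV (\<phi> s)"
  shows "continuous_on UNIV (\<lambda>c. shoot K \<phi> c k)"
  using assms
proof (induction k rule: less_induct)
  case (less k)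
  have "continuous_on UNIV (\<lambda>c. \<phi> s (shoot K \<phi> c s))" if "s < k" for s
  proof (rule continuous_on_compose2[of UNIV "\<phi> s"])
    show "continuous_on UNIV (\<lambda>c. shoot K \<phi> c s)"
      using less that by auto
  qed (use less.prems that in auto)
  then show ?case
    unfolding shoot.simps[of K \<phi> _ k] by (intro continuous_intros) auto
qed

text \<open>
  Since \<open>\<phi>\<close> lies between \<open>0\<close> and \<open>M\<close>, the value at \<open>N\<close> is nonpositive for \<open>c = 0\<close> and nonnegative
  once \<open>c * K N\<close> reaches the largest possible value \<open>B\<close> of the sum that is subtracted.
\<close>

lemma shoot_hits_zero:
  assumes "0 < K N" "\<And>k. 0 \<le> K k"
    and "\<And>s. s < N \<Longrightarrow> continuous_on UNIV (\<phi> s)"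
    and "\<And>s x. s < N \<Longrightarrow> 0 \<le> \<phi> s x"
    and "\<And>s x. s < N \<Longrightarrow> \<phi> s x \<le> M s"
  shows "\<exists>c. shoot K \<phi> c N = 0"
proof -
  define B where "B = (\<Sum>s<N. K (N - 1 - s) * M s)"
  have M: "0 \<le> M s" if "s < N" for s
    using assms(4,5)[OF that] order_trans by blast
  have "0 \<le> B"
    unfolding B_def using assms(2) M by (intro sum_nonneg) auto
  have "shoot K \<phi> 0 N \<le> 0"
    using assms(2,4) by (auto simp: shoot.simps[of K \<phi> _ N] intro!: sum_nonneg)
  moreover have "0 \<le> shoot K \<phi> (B / K N) N"
  proof -
    have "(\<Sum>s<N. K (N - 1 - s) * \<phi> s (shoot K \<phi> (B / K N) s)) \<le> B"
      unfolding B_def using assms(2,5) by (intro sum_mono mult_left_mono) auto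
    then show ?thesis using assms(1) by (simp add: shoot.simps[of K \<phi> _ N])
  qed
  moreover have "continuous_on {0..B / K N} (\<lambda>c. shoot K \<phi> c N)"
    using continuous_on_shoot[of N \<phi> K] assms(3) continuous_on_subset by blast
  ultimately show ?thesis
    using IVT'[of "\<lambda>c. shoot K \<phi> c N" 0 0 "B / K N"] \<open>0 \<le> B\<close> assms(1) by auto
qed

section \<open>The grid of the boundary value problem\<close>

text \<open>
  The summation range of \<open>gamma_star_sum\<close> consists of indices at which the inequality of
  \<open>green_constant\<close> is available; the index \<open>0\<close> is excluded because \<open>(b + \<alpha>) / 4 > 0\<close>.
\<close>

lemma gamma_star_range:
  assumes "1 < \<alpha>" "\<alpha> \<le> 2" "2 \<le> b"
    and "(real b + \<alpha>) / 4 \<le> real s" "real s \<le> 3 * (real b + \<alpha>) / 4"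
  shows "1 \<le> s" "s \<le> b + 1"
proof -
  have "0 < (real b + \<alpha>) / 4" using assms(1) by simp
  then have "0 < real s" using assms(4) by linarith
  then show "1 \<le> s" by simp
  have "real s \<le> real (b + 1)" using assms by simp
  then show "s \<le> b + 1" by (simp only: of_nat_le_iff)
qed

text \<open>
  The middle half of the interval has length \<open>(b + \<alpha>) / 2 \<ge> 1\<close> and does not start to the left
  of the first interior grid point, so it contains a grid point.
\<close>

lemma quarter_grid_point:
  assumes "1 < \<alpha>" "\<alpha> \<le> 2" "2 \<le> b"
  obtains i where "i \<le> b + 1"
    "\<alpha> - 1 + real i \<in> discrete_ivl ((real b + \<alpha>) / 4) (3 * (real b + \<alpha>) / 4) (\<alpha> - 1)"
proof
  let ?x = "(real b + \<alpha>) / 4 - (\<alpha> - 1)"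
  let ?i = "nat \<lceil>?x\<rceil>"
  have "0 \<le> ?x" using assms by (simp add: field_simps)
  then have "real ?i = of_int \<lceil>?x\<rceil>" by simp
  then have i: "?x \<le> real ?i" "real ?i < ?x + 1"
    using ceiling_correct[of ?x] by linarith+
  then have "real ?i \<le> real (b + 1)" using assms by (simp add: field_simps)
  then show "?i \<le> b + 1" by (simp only: of_nat_le_iff)
  have "3 * (real b + \<alpha>) / 4 = (real b + \<alpha>) / 4 + (real b + \<alpha>) / 2" by (simp add: field_simps)
  moreover have "1 \<le> (real b + \<alpha>) / 2" using assms by simp
  ultimately have "\<alpha> - 1 + real ?i \<le> 3 * (real b + \<alpha>) / 4"
    using i by linarith
  moreover have "(real b + \<alpha>) / 4 \<le> \<alpha> - 1 + real ?i" using i by linarith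
  ultimately show "\<alpha> - 1 + real ?i \<in> discrete_ivl ((real b + \<alpha>) / 4) (3 * (real b + \<alpha>) / 4) (\<alpha> - 1)"
    unfolding discrete_ivl_def shifted_nats_def Int_iff atLeastAtMost_iff by blast
qed

lemma interior_grid:
  "discrete_ivl (\<alpha> - 1) (\<alpha> + real b) (\<alpha> - 1) = (\<lambda>i. \<alpha> - 1 + real i) ` {..b + 1}"
  using discrete_ivl_eq_image[of "\<alpha> - 1" "b + 1"] by (simp add: add_ac)

lemma full_grid:
  "discrete_ivl (\<alpha> - 2) (\<alpha> + real b + 1) (\<alpha> - 2) = (\<lambda>k. \<alpha> - 2 + real k) ` {..b + 3}"
  using discrete_ivl_eq_image[of "\<alpha> - 2" "b + 3"] by (simp add: add_ac)

lemma green_lower_bound: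
  assumes "green_constant \<alpha> b c" "1 \<le> s" "s \<le> b + 1"
    and t: "t \<in> discrete_ivl ((real b + \<alpha>) / 4) (3 * (real b + \<alpha>) / 4) (\<alpha> - 1)"
  shows "c * green \<alpha> b (\<alpha> - 1 + real s) s \<le> green \<alpha> b t s"
proof -
  let ?I = "discrete_ivl (\<alpha> - 1) (\<alpha> + real b) (\<alpha> - 1)"
  let ?J = "discrete_ivl ((real b + \<alpha>) / 4) (3 * (real b + \<alpha>) / 4) (\<alpha> - 1)"
  have "green \<alpha> b (\<alpha> - 1 + real s) s \<le> Max ((\<lambda>t. green \<alpha> b t s) ` ?I)"
    using assms(3) by (intro Max_ge) (auto simp: interior_grid)
  then have "c * green \<alpha> b (\<alpha> - 1 + real s) s \<le> c * Max ((\<lambda>t. green \<alpha> b t s) ` ?I)"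
    using assms(1) by (intro mult_left_mono) (auto simp: green_constant_def)
  also have "\<dots> \<le> Min ((\<lambda>t. green \<alpha> b t s) ` ?J)"
    using assms by (auto simp: green_constant_def)
  also have "\<dots> \<le> green \<alpha> b t s"
    using t by (intro Min_le) (auto simp: finite_discrete_ivl)
  finally show ?thesis .
qed

section \<open>Existence of a positive solution\<close>

text \<open>
  Transfers a sequence indexed from \<open>0\<close> at \<open>\<alpha> - 1\<close> to the grid. The left end point is treated
  separately since its index would be \<open>-1\<close>.
\<close>

definition grid_extension :: "real \<Rightarrow> nat \<Rightarrow> (nat \<Rightarrow> real) \<Rightarrow> real \<Rightarrow> real" where
  "grid_extension \<alpha> b y =
     restrict (\<lambda>t. if t = \<alpha> - 2 then 0 else y (nat \<lfloor>t - (\<alpha> - 1)\<rfloor>))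
       (discrete_ivl (\<alpha> - 2) (\<alpha> + real b + 1) (\<alpha> - 2))"

lemma grid_extension_left: "grid_extension \<alpha> b y (\<alpha> - 2) = 0"
  by (auto simp: grid_extension_def full_grid)

lemma grid_extension_interior:
  assumes "i \<le> b + 2"
  shows "grid_extension \<alpha> b y (\<alpha> - 1 + real i) = y i"
proof -
  have "\<alpha> - 1 + real i = \<alpha> - 2 + real (Suc i)" by simp
  then have "\<alpha> - 1 + real i \<in> (\<lambda>k. \<alpha> - 2 + real k) ` {..b + 3}"
    using assms by (intro image_eqI[of _ _ "Suc i"]) auto
  then show ?thesis by (auto simp: grid_extension_def full_grid)
qed

lemma full_grid_cases:
  assumes "t \<in> discrete_ivl (\<alpha> - 2) (\<alpha> + real b + 1) (\<alpha> - 2)"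
  obtains "t = \<alpha> - 2" | i where "i \<le> b + 2" "t = \<alpha> - 1 + real i"
proof -
  obtain k where k: "k \<le> b + 3" "t = \<alpha> - 2 + real k"
    using assms by (auto simp: full_grid)
  show thesis
  proof (cases k)
    case 0
    then show thesis using k that(1) by simp
  next
    case (Suc i)
    then show thesis using k that(2)[of i] by simp
  qed
qed

theorem theorem2:
  fixes \<alpha> :: real and b :: nat and f q :: "real \<Rightarrow> real" and lam r1 r2 :: real
  assumes "1 < \<alpha>" and "\<alpha> \<le> 2" and "2 \<le> b"
    and "continuous_on {0..} f" and "\<forall>x\<ge>0. f x \<ge> 0"
    and "\<forall>t\<in>discrete_ivl (\<alpha> - 1) (\<alpha> + real b) (\<alpha> - 1). q t \<ge> 0"
    and "\<exists>t\<in>discrete_ivl (\<alpha> - 1) (\<alpha> + real b) (\<alpha> - 1). q t \<noteq> 0"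
    and "green_constant \<alpha> b lam"
    and "gamma_star_sum \<alpha> b q lam \<noteq> 0"
    and "0 < r1" and "r1 < r2"
    and "\<forall>x\<in>{0..r1}. f x \<ge> gamma_star \<alpha> b q lam * r1"
    and "\<forall>x\<in>{0..r2}. f x \<le> gamma_const \<alpha> b q * r2"
  shows "\<exists>y. bvp_positive_solution \<alpha> b q f y \<and>
           (\<exists>t\<in>discrete_ivl (\<alpha> - 2) (\<alpha> + real b + 1) (\<alpha> - 2). y t \<noteq> 0) \<and>
           r1 \<le> bvp_norm \<alpha> b y \<and> bvp_norm \<alpha> b y \<le> r2"
proof -
  let ?K = "rising_coeff \<alpha>" 
  obtain N where N: "N = b + 2" by simp
  let ?G = "conv_green ?K N"
  define Q where "Q s = q (\<alpha> - 1 + real s)" for s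
  define \<phi> where "\<phi> s x = Q s * f (max 0 (min x r2))" for s x
  have Q: "0 \<le> Q s" if "s < N" for s
    using assms(6) that unfolding Q_def interior_grid by (auto simp: N)
  have K: "0 < ?K k" for k
    using assms(1) by (intro rising_coeff_pos) simp
  have green: "green \<alpha> b (\<alpha> - 1 + real i) s = ?G i s" if "s < N" for i s
    using green_eq_conv_green[of \<alpha> s b i] that assms(1) by (simp add: N)
  have Gpos: "0 < ?G i s" if "i < N" "s < N" for i s
    using conv_green_pos assms(1) that by blast
  have Gdiag: "?G i s \<le> ?G s s" if "s < N" for i s
    using conv_green_le_diagonal[of \<alpha> s N i] assms(1,2) that by simp
  have range_eq: "{0..b + 1} = {..<N}" by (auto simp: N)
  have comm: "real s + \<alpha> - 1 = \<alpha> - 1 + real s" for s by simp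

  \<comment> \<open>The truncated problem has a solution.\<close>
  have "\<exists>c. shoot ?K \<phi> c N = 0"
  proof (rule shoot_hits_zero)
    fix s assume s: "s < N"
    have "continuous_on UNIV (\<lambda>x. f (max 0 (min x r2)))"
      by (rule continuous_on_compose2[OF assms(4)]) (auto intro!: continuous_intros)
    then show "continuous_on UNIV (\<phi> s)"
      unfolding \<phi>_def by (intro continuous_intros)
    fix x
    show "0 \<le> \<phi> s x" using Q[OF s] assms(5) by (simp add: \<phi>_def)
    show "\<phi> s x \<le> Q s * (gamma_const \<alpha> b q * r2)"
      unfolding \<phi>_def using Q[OF s] assms(10,11,13) by (intro mult_left_mono) auto
  qed (use K in \<open>simp_all add: less_imp_le\<close>)
  then obtain c where c: "shoot ?K \<phi> c N = 0" by blast
  define y where "y = shoot ?K \<phi> c"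
  define F where "F s = \<phi> s (y s)" for s
  have rec: "y k = c * ?K k - (\<Sum>s<k. ?K (k - 1 - s) * F s)" for k
    unfolding y_def F_def by (rule shoot.simps)
  have yG: "y i = (\<Sum>s<N. ?G i s * F s)" if "i \<le> N" for i
  proof (rule conv_green_representation[OF _ rec _ that])
    show "?K N \<noteq> 0" using K[of N] by simp
    show "y N = 0" using c by (simp only: y_def)
  qed

  have F_nonneg: "0 \<le> F s" if "s < N" for s
    using Q[OF that] assms(5) by (simp add: F_def \<phi>_def)
  have y_nonneg: "0 \<le> y i" if "i < N" for i
    using yG[of i] that Gpos F_nonneg by (auto intro!: sum_nonneg simp: less_imp_le)
  have y_le: "y i \<le> r2" if "i < N" for i
  proof -
    let ?S = "\<Sum>s<N. ?G s s * Q s"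
    have gamma: "gamma_const \<alpha> b q = inverse ?S"
      unfolding gamma_const_def range_eq comm by (simp add: green Q_def)
    have "y i = (\<Sum>s<N. ?G i s * F s)" using yG that by simp
    also have "\<dots> \<le> (\<Sum>s<N. ?G s s * (Q s * (inverse ?S * r2)))"
    proof (rule sum_mono)
      fix s assume "s \<in> {..<N}"
      then have s: "s < N" by simp
      have "F s \<le> Q s * (inverse ?S * r2)"
        unfolding F_def \<phi>_def using Q[OF s] assms(10,11,13) gamma by (intro mult_left_mono) auto
      then show "?G i s * F s \<le> ?G s s * (Q s * (inverse ?S * r2))"
        using Gdiag[OF s] Gpos[OF s s] F_nonneg[OF s] by (intro mult_mono) auto
    qed
    also have "\<dots> = ?S * inverse ?S * r2"
      by (simp only: sum_distrib_right mult.assoc)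
    \<comment> \<open>If the sum is zero then so is its inverse, and the product is \<open>0 \<le> r2\<close>.\<close>
    also have "\<dots> \<le> r2"
      using assms(10,11) by (cases "?S = 0") auto
    finally show ?thesis .
  qed
  \<comment> \<open>The bounds just proved show that the truncation has no effect along \<open>y\<close>.\<close>
  have F: "F s = Q s * f (y s)" if "s < N" for s
    using y_nonneg[OF that] y_le[OF that] by (simp add: F_def \<phi>_def)

  \<comment> \<open>Small values of \<open>y\<close> force a large value in the middle half, by the choice of \<open>gamma_star\<close>.\<close>
  have "\<exists>i<N. r1 \<le> y i"
  proof (rule ccontr)
    assume "\<not> ?thesis"
    then have small: "y i < r1" if "i < N" for i using that by force
    let ?A = "{s :: nat. (real b + \<alpha>) / 4 \<le> real s \<and> real s \<le> 3 * (real b + \<alpha>) / 4}"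
    let ?J = "discrete_ivl ((real b + \<alpha>) / 4) (3 * (real b + \<alpha>) / 4) (\<alpha> - 1)"
    let ?g = "gamma_star \<alpha> b q lam"
    obtain i where "i \<le> b + 1" and i_mid: "\<alpha> - 1 + real i \<in> ?J"
      by (rule quarter_grid_point[OF assms(1-3)])
    then have iN: "i < N" by (simp add: N)
    have A: "1 \<le> s" "s \<le> b + 1" if "s \<in> ?A" for s
      using gamma_star_range[OF assms(1-3), of s] that by blast+
    have "r1 = gamma_star_sum \<alpha> b q lam * ?g * r1"
      using assms(9) by (simp add: gamma_star_def)
    also have "\<dots> = (\<Sum>s\<in>?A. lam * green \<alpha> b (\<alpha> - 1 + real s) s * (Q s * (?g * r1)))"
      by (simp only: gamma_star_sum_def comm Q_def sum_distrib_right mult.assoc)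
    also have "\<dots> \<le> (\<Sum>s\<in>?A. ?G i s * F s)"
    proof (rule sum_mono)
      fix s assume s: "s \<in> ?A"
      have sN: "s < N" using A[OF s] by (simp add: N)
      have "lam * green \<alpha> b (\<alpha> - 1 + real s) s \<le> ?G i s"
        using green_lower_bound[OF assms(8) A[OF s] i_mid] green[OF sN] by simp
      moreover have "?g * r1 \<le> f (y s)"
        using assms(12) y_nonneg[OF sN] small[OF sN] by auto
      then have "Q s * (?g * r1) \<le> F s"
        using F[OF sN] Q[OF sN] by (simp add: mult_left_mono)
      moreover have "0 \<le> lam * green \<alpha> b (\<alpha> - 1 + real s) s"
        using assms(8) green[OF sN] Gpos[OF sN sN] by (simp add: green_constant_def)
      ultimately show "lam * green \<alpha> b (\<alpha> - 1 + real s) s * (Q s * (?g * r1)) \<le> ?G i s * F s"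
        using F_nonneg[OF sN] Gpos[of i s] sN iN
        by (meson mult_left_mono mult_right_mono order_trans)
    qed
    also have "\<dots> \<le> (\<Sum>s<N. ?G i s * F s)"
    proof (rule sum_mono2)
      show "?A \<subseteq> {..<N}"
      proof
        fix s assume "s \<in> ?A"
        from A(2)[OF this] show "s \<in> {..<N}" by (simp add: N)
      qed
      show "0 \<le> ?G i s * F s" if "s \<in> {..<N} - ?A" for s
        using that Gpos[OF iN, of s] F_nonneg[of s] by simp
    qed simp
    also have "\<dots> = y i" using yG iN by simp
    finally show False using small[of i] iN by simp
  qed
  then obtain m where m: "m < N" "r1 \<le> y m" by blast

  \<comment> \<open>A single positive source makes \<open>y\<close> positive at all interior points.\<close>
  have "\<exists>s<N. 0 < F s"
  proof (rule ccontr)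
    assume "\<not> ?thesis"
    then have "F s = 0" if "s < N" for s using F_nonneg[OF that] that by force
    then have "y m = 0" using yG[of m] m(1) by simp
    then show False using m(2) assms(10) by simp
  qed
  then obtain s where s: "s < N" "0 < F s" by blast
  have y_pos: "0 < y i" if "i < N" for i
  proof -
    have "0 < (\<Sum>s<N. ?G i s * F s)"
      using s that Gpos F_nonneg by (intro sum_pos2[of _ s]) (auto simp: less_imp_le)
    then show ?thesis using yG that by simp
  qed

  define z where "z = grid_extension \<alpha> b y"
  have z: "z (\<alpha> - 1 + real i) = y i" if "i \<le> N" for i
    unfolding z_def using that by (intro grid_extension_interior) (simp add: N)
  have z_left: "z (\<alpha> - 2) = 0"
    unfolding z_def by (rule grid_extension_left)
  have z_right: "z (\<alpha> + real b + 1) = 0"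
    using z[of N] c by (simp add: y_def N add_ac)
  have eq: "frac_diff (\<alpha> - 2) \<alpha> z (real t) = - F t" if "t \<le> b + 1" for t
  proof (rule frac_diff_of_convolution[where c = c])
    show "z (\<alpha> - 1 + real k) = c * ?K k - (\<Sum>s<k. ?K (k - 1 - s) * F s)" if "k \<le> Suc t" for k
      using z[of k] rec[of k] \<open>t \<le> b + 1\<close> that by (simp add: N)
  qed (use assms(1,2) z_left in simp_all)
  have sol: "bvp_positive_solution \<alpha> b q f z"
    unfolding bvp_positive_solution_def bvp_solution_def bvp_space_def
    using z_left z_right eq F z y_pos
    by (auto simp: interior_grid comm Q_def N) (simp add: z_def grid_extension_def)
  let ?I = "discrete_ivl (\<alpha> - 2) (\<alpha> + real b + 1) (\<alpha> - 2)"
  have bound: "\<bar>z t\<bar> \<le> r2" if "t \<in> ?I" for t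
    using that
  proof (cases rule: full_grid_cases)
    case 1
    then show ?thesis using z_left assms(10,11) by simp
  next
    case (2 i)
    then show ?thesis
      using z[of i] y_nonneg[of i] y_le[of i] c assms(10,11) by (cases "i = N") (auto simp: y_def N)
  qed
  have "\<alpha> - 1 + real m = \<alpha> - 2 + real (Suc m)" by simp
  then have m_mem: "\<alpha> - 1 + real m \<in> ?I"
    unfolding full_grid using m(1) by (intro image_eqI[of _ _ "Suc m"]) (auto simp: N)
  have zm: "r1 \<le> z (\<alpha> - 1 + real m)" using z[of m] m by simp
  have "bvp_norm \<alpha> b z \<le> r2"
    unfolding bvp_norm_def using bound m_mem by (intro cSUP_least) auto
  moreover have "\<bar>z (\<alpha> - 1 + real m)\<bar> \<le> bvp_norm \<alpha> b z"
    unfolding bvp_norm_def using m_mem bound by (intro cSUP_upper bdd_aboveI2) auto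
  then have "r1 \<le> bvp_norm \<alpha> b z" using zm by simp
  ultimately show ?thesis
    using sol zm m_mem assms(10) by (intro exI[of _ z]) force
qed

end
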